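(* Let $\mathcal{U}$ be a compact uncertainty set satisfying Assumption 1, and suppose the algorithm described in the context, run on $\mathcal{U}$, returns $\beta$ and $v$. Then $v\in\mathcal{U}$. Furthermore, the piecewise affine policy with parameters $\beta$ and $v$, $$x=2\hat x,\qquad y(h)=\frac1\beta\sum_{i=1}^m(h_i-\beta v_i)^+\,\hat y(\beta e_i)+\hat y(\beta v)\quad\text{for all }h\in\mathcal{U},$$ where $(\hat x,\hat y(\cdot))$ is an optimal solution of $\Pi_{AR}\big(\beta\cdot\mathrm{conv}(e_1,\dots,e_m,v)\big)$, gives an $O(\sqrt m)$-approximation for $\Pi_{AR}(\mathcal{U})$; that is, a $C\sqrt m$-approximation for an absolute constant $C$ (independent of $m$, $\mathcal{U}$ and the data $(A,B,c,d)$).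
   Context: Vector inequalities are componentwise; $e_i$ is the $i$-th standard basis vector of $\mathbb{R}^m$; $(a)^+=\max(a,0)$; $\mathrm{conv}$ denotes convex hull. Two-stage adjustable robust problem $\Pi_{AR}(\mathcal{S})$: the data are $A\in\mathbb{R}_+^{m\times n}$, $B\in\mathbb{R}^{m\times n}$, $c,d\in\mathbb{R}^n_+$. For a set $\mathcal{S}\subseteq\mathbb{R}^m_+$, a feasible solution is a pair $(x,y(\cdot))$ with $x\in\mathbb{R}^n_+$, $y:\mathcal{S}\to\mathbb{R}^n_+$ and $Ax+By(h)\ge h$ for all $h\in\mathcal{S}$; the optimal value $z_{AR}(\mathcal{S})$ is the minimum (infimum) over feasible solutions of the worst-case cost $c^Tx+\max_{h\in\mathcal{S}}d^Ty(h)$ (max read as supremum; value $+\infty$ if infeasible). An optimal solution is a feasible solution whose worst-case cost equals $z_{AR}(\mathcal{S})<\infty$. A solution $(x,y(\cdot))$ gives an $\alpha$-approximation for $\Pi_{AR}(\mathcal{U})$ if it is feasible for $\Pi_{AR}(\mathcal{U})$ and $c^Tx+d^Ty(h)\le\alpha\cdot z_{AR}(\mathcal{U})$ for all $h\in\mathcal{U}$. Assumption 1 on $\mathcal{U}$: $\mathcal{U}\subseteq[0,1]^m$ is convex, full-dimensional, $e_i\in\mathcal{U}$ for all $i=1,\dots,m$, and down-monotone, i.e. $h\in\mathcal{U}$ and $0\le h'\le h$ imply $h'\in\mathcal{U}$. Algorithm (input $\mathcal{U}$): initialize $t=0$, $u^0=0\in\mathbb{R}^m$. While $\max_{h\in\mathcal{U}}\sum_{i=1}^m(h_i-u^t_i)^+>t$: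 choose $h^t\in\operatorname{argmax}_{h\in\mathcal{U}}\sum_{i=1}^m(h_i-u^t_i)^+$; for each $i=1,\dots,m$, if $u^t_i=1$ reset $h^t_i=0$, then set $u^{t+1}_i=\min(1,u^t_i+h^t_i)$; then replace $t$ by $t+1$. When the loop ends, return $\beta=t$ and $v=u^t/\beta$. *)

theory Defs
  imports "HOL-Analysis.Analysis" "HOL-Library.Function_Algebras"
begin

text \<open>
  The approximation constant must not depend on the dimensions, so these have to be quantified
  inside the statement. \<open>\<real>\<^sup>m\<close> is therefore the set of all \<open>h :: nat \<Rightarrow> real\<close> vanishing outside
  \<open>{0,\<dots>,m-1}\<close>, with the topology \<^const>\<open>Euclidean_space\<close>; coordinates are numbered from \<open>0\<close>.
  The order on \<open>nat \<Rightarrow> real\<close> is componentwise, and the pointwise vector space structure below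
  makes \<^const>\<open>convex\<close>, \<^const>\<open>hull\<close> and \<^const>\<open>affine\<close> available.
\<close>

instantiation "fun" :: (type, real_vector) real_vector
begin

definition scaleR_fun_def: "r *\<^sub>R f = (\<lambda>x. r *\<^sub>R f x)"

instance
  by standard (simp_all add: scaleR_fun_def fun_eq_iff scaleR_add_right scaleR_add_left)

end

lemma scaleR_fun_apply [simp]: "(r *\<^sub>R f) x = r *\<^sub>R f x"
  by (simp add: scaleR_fun_def)

type_synonym rvec = "nat \<Rightarrow> real"
type_synonym rmat = "nat \<Rightarrow> nat \<Rightarrow> real"

definition Rspace :: "nat \<Rightarrow> rvec set" where
  "Rspace m = topspace (Euclidean_space m)"

definition Rspace_nonneg :: "nat \<Rightarrow> rvec set" where
  "Rspace_nonneg m = {x \<in> Rspace m. 0 \<le> x}"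

definition unit_vector :: "nat \<Rightarrow> rvec" where
  "unit_vector i = (\<lambda>j. if j = i then 1 else 0)"

definition dot :: "nat \<Rightarrow> rvec \<Rightarrow> rvec \<Rightarrow> real" where
  "dot n x y = (\<Sum>j<n. x j * y j)"

text \<open>Only the entries \<open>A i j\<close> with \<open>i < m\<close> and \<open>j < n\<close> of an \<open>m \<times> n\<close> matrix are ever used.\<close>

definition mat_vec :: "nat \<Rightarrow> rmat \<Rightarrow> rvec \<Rightarrow> rvec" where
  "mat_vec n A x = (\<lambda>i. \<Sum>j<n. A i j * x j)"

definition pos_part :: "real \<Rightarrow> real" where
  "pos_part a = max a 0"


section \<open>The two-stage adjustable robust problem\<close>

definition AR_data :: "nat \<Rightarrow> nat \<Rightarrow> rmat \<Rightarrow> rvec \<Rightarrow> rvec \<Rightarrow> bool" where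
  "AR_data m n A c d \<longleftrightarrow>
     (\<forall>i<m. \<forall>j<n. 0 \<le> A i j) \<and> c \<in> Rspace_nonneg n \<and> d \<in> Rspace_nonneg n"

definition AR_feasible ::
  "nat \<Rightarrow> nat \<Rightarrow> rmat \<Rightarrow> rmat \<Rightarrow> rvec set \<Rightarrow> rvec \<Rightarrow> (rvec \<Rightarrow> rvec) \<Rightarrow> bool" where
  "AR_feasible m n A B S x y \<longleftrightarrow>
     x \<in> Rspace_nonneg n \<and>
     (\<forall>h\<in>S. y h \<in> Rspace_nonneg n \<and> (\<forall>i<m. h i \<le> mat_vec n A x i + mat_vec n B (y h) i))"

definition AR_cost ::
  "nat \<Rightarrow> rvec \<Rightarrow> rvec \<Rightarrow> rvec set \<Rightarrow> rvec \<Rightarrow> (rvec \<Rightarrow> rvec) \<Rightarrow> ereal" where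
  "AR_cost n c d S x y = ereal (dot n c x) + (SUP h\<in>S. ereal (dot n d (y h)))"

definition z_AR ::
  "nat \<Rightarrow> nat \<Rightarrow> rmat \<Rightarrow> rmat \<Rightarrow> rvec \<Rightarrow> rvec \<Rightarrow> rvec set \<Rightarrow> ereal" where
  "z_AR m n A B c d S = Inf {AR_cost n c d S x y | x y. AR_feasible m n A B S x y}"

definition AR_optimal ::
  "nat \<Rightarrow> nat \<Rightarrow> rmat \<Rightarrow> rmat \<Rightarrow> rvec \<Rightarrow> rvec \<Rightarrow> rvec set \<Rightarrow> rvec \<Rightarrow> (rvec \<Rightarrow> rvec) \<Rightarrow> bool" where
  "AR_optimal m n A B c d S x y \<longleftrightarrow>
     AR_feasible m n A B S x y \<and>
     AR_cost n c d S x y = z_AR m n A B c d S \<and> z_AR m n A B c d S < \<infinity>"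

definition AR_approximation ::
  "nat \<Rightarrow> nat \<Rightarrow> rmat \<Rightarrow> rmat \<Rightarrow> rvec \<Rightarrow> rvec \<Rightarrow> rvec set \<Rightarrow> real
     \<Rightarrow> rvec \<Rightarrow> (rvec \<Rightarrow> rvec) \<Rightarrow> bool" where
  "AR_approximation m n A B c d U \<alpha> x y \<longleftrightarrow>
     AR_feasible m n A B U x y \<and>
     (\<forall>h\<in>U. ereal (dot n c x + dot n d (y h)) \<le> ereal \<alpha> * z_AR m n A B c d U)"


section \<open>Uncertainty sets and the algorithm\<close>

definition Assumption1 :: "nat \<Rightarrow> rvec set \<Rightarrow> bool" where
  "Assumption1 m U \<longleftrightarrow>
     U \<subseteq> {h \<in> Rspace m. \<forall>i<m. 0 \<le> h i \<and> h i \<le> 1} \<and>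
     convex U \<and>
     affine hull U = Rspace m \<and>
     (\<forall>i<m. unit_vector i \<in> U) \<and>
     (\<forall>h\<in>U. \<forall>h'\<in>Rspace m. 0 \<le> h' \<and> h' \<le> h \<longrightarrow> h' \<in> U)"

definition excess :: "nat \<Rightarrow> rvec \<Rightarrow> rvec \<Rightarrow> real" where
  "excess m u h = (\<Sum>i<m. pos_part (h i - u i))"

definition alg_update :: "rvec \<Rightarrow> rvec \<Rightarrow> rvec" where
  "alg_update u h = (\<lambda>i. min 1 (u i + (if u i = 1 then 0 else h i)))"

text \<open>
  \<open>alg_reaches m U t u\<close>: some run of the algorithm, with some choice of the maximisers,
  arrives at the loop test with counter \<open>t\<close> and \<open>u\<^sup>t = u\<close>.
\<close>

inductive alg_reaches :: "nat \<Rightarrow> rvec set \<Rightarrow> nat \<Rightarrow> rvec \<Rightarrow> bool" for m U where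
  init: "alg_reaches m U 0 0"
| step: "alg_reaches m U t u \<Longrightarrow> (SUP h\<in>U. excess m u h) > real t \<Longrightarrow>
         is_arg_max (excess m u) (\<lambda>h. h \<in> U) h \<Longrightarrow>
         alg_reaches m U (Suc t) (alg_update u h)"

definition alg_returns :: "nat \<Rightarrow> rvec set \<Rightarrow> nat \<Rightarrow> rvec \<Rightarrow> bool" where
  "alg_returns m U \<beta> v \<longleftrightarrow>
     (\<exists>u. alg_reaches m U \<beta> u \<and> \<not> (SUP h\<in>U. excess m u h) > real \<beta> \<and>
          v = (1 / real \<beta>) *\<^sub>R u)"


section \<open>The piecewise affine policy\<close>

definition scaled_simplex :: "nat \<Rightarrow> nat \<Rightarrow> rvec \<Rightarrow> rvec set" where
  "scaled_simplex m \<beta> v =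
     (\<lambda>h. real \<beta> *\<^sub>R h) ` (convex hull (insert v (unit_vector ` {..<m})))"

definition pw_affine_policy ::
  "nat \<Rightarrow> nat \<Rightarrow> rvec \<Rightarrow> (rvec \<Rightarrow> rvec) \<Rightarrow> rvec \<Rightarrow> rvec" where
  "pw_affine_policy m \<beta> v yhat h =
     (1 / real \<beta>) *\<^sub>R
       (\<Sum>i<m. pos_part (h i - real \<beta> * v i) *\<^sub>R yhat (real \<beta> *\<^sub>R unit_vector i))
     + yhat (real \<beta> *\<^sub>R v)"

end

theory Submission
  imports Defs
begin

text \<open>
  The stopping rule says that the excess over \<open>u = \<beta> v\<close> is at most \<open>\<beta>\<close> on \<open>\<U>\<close>, so in the policy
  the recourse vectors for the points \<open>\<beta> e\<^sub>i\<close> carry total weight at most \<open>1\<close>. Hence two copies of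
  \<open>x\<close> compensate for the first stage and the cost is at most twice the optimum over
  \<open>\<beta> conv(e\<^sub>1,\<dots>,e\<^sub>m,v)\<close>. This set lies in \<open>\<beta> \<U>\<close>, because \<open>v\<close> is dominated by the average of the
  chosen maximisers, so scaling solutions loses a further factor \<open>\<beta>\<close>. Finally, step \<open>t\<close> increases
  the sum of the coordinates of \<open>u\<close> by more than \<open>t\<close>, and this sum never exceeds \<open>m\<close>, which gives
  \<open>\<beta> (\<beta> - 1) / 2 \<le> m\<close>.
\<close>

section \<open>Nonnegative vectors and linear functionals\<close>

lemma sum_fun_apply: "(\<Sum>i\<in>I. f i) x = (\<Sum>i\<in>I. f i x)"
  for f :: "'i \<Rightarrow> 'a \<Rightarrow> 'b::comm_monoid_add"
  by (induction I rule: infinite_finite_induct) auto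

lemma Rspace_iff: "x \<in> Rspace m \<longleftrightarrow> (\<forall>i\<ge>m. x i = 0)"
  by (simp add: Rspace_def topspace_Euclidean_space)

lemma Rspace_nonneg_iff: "x \<in> Rspace_nonneg m \<longleftrightarrow> (\<forall>i. 0 \<le> x i) \<and> (\<forall>i\<ge>m. x i = 0)"
  by (auto simp: Rspace_nonneg_def Rspace_iff le_fun_def)

lemma Rspace_nonneg_add: "x \<in> Rspace_nonneg m \<Longrightarrow> y \<in> Rspace_nonneg m \<Longrightarrow> x + y \<in> Rspace_nonneg m"
  by (auto simp: Rspace_nonneg_iff)

lemma Rspace_nonneg_scaleR: "0 \<le> r \<Longrightarrow> x \<in> Rspace_nonneg m \<Longrightarrow> r *\<^sub>R x \<in> Rspace_nonneg m"
  by (auto simp: Rspace_nonneg_iff)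

lemma Rspace_nonneg_sum:
  "(\<And>i. i \<in> I \<Longrightarrow> f i \<in> Rspace_nonneg m) \<Longrightarrow> (\<Sum>i\<in>I. f i) \<in> Rspace_nonneg m"
  by (auto simp: Rspace_nonneg_iff sum_fun_apply intro!: sum_nonneg sum.neutral)

lemma dot_add: "dot n c (x + y) = dot n c x + dot n c y"
  by (simp add: dot_def algebra_simps sum.distrib)

lemma dot_scaleR: "dot n c (r *\<^sub>R x) = r * dot n c x"
  by (simp add: dot_def sum_distrib_left algebra_simps)

lemma dot_sum: "dot n c (\<Sum>i\<in>I. f i) = (\<Sum>i\<in>I. dot n c (f i))"
  unfolding dot_def sum_fun_apply sum_distrib_left by (rule sum.swap)

lemma dot_nonneg: "c \<in> Rspace_nonneg n \<Longrightarrow> x \<in> Rspace_nonneg n \<Longrightarrow> 0 \<le> dot n c x"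
  by (auto simp: dot_def Rspace_nonneg_iff intro!: sum_nonneg)

lemma mat_vec_eq_dot: "mat_vec n A x i = dot n (A i) x"
  by (simp add: mat_vec_def dot_def)

lemma pos_part_nonneg: "0 \<le> pos_part a"
  by (simp add: pos_part_def)

section \<open>Uncertainty sets and runs of the algorithm\<close>

lemma Assumption1_bounds:
  assumes "Assumption1 m U" "h \<in> U"
  shows "0 \<le> h i" "h i \<le> 1" "i \<ge> m \<Longrightarrow> h i = 0"
proof -
  have U: "U \<subseteq> {h \<in> Rspace m. \<forall>i<m. 0 \<le> h i \<and> h i \<le> 1}"
    using assms(1) by (simp add: Assumption1_def)
  then show zero: "i \<ge> m \<Longrightarrow> h i = 0"
    using assms(2) by (auto simp: Rspace_iff)
  show "0 \<le> h i" "h i \<le> 1"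
    using U assms(2) zero by (cases "i < m"; auto)+
qed

lemma Assumption1_down:
  assumes "Assumption1 m U" "h \<in> U" "\<And>i. 0 \<le> g i" "\<And>i. g i \<le> h i"
  shows "g \<in> U"
proof -
  have "g i = 0" if "i \<ge> m" for i
    using assms(3,4)[of i] Assumption1_bounds(3)[OF assms(1,2) that] by simp
  then have "g \<in> Rspace m"
    by (simp add: Rspace_iff)
  with assms show ?thesis
    by (auto simp: Assumption1_def le_fun_def)
qed

text \<open>The supremum in the loop test is taken in the reals, so it bounds its members only once
  boundedness is known.\<close>

lemma excess_bdd_above:
  assumes "Assumption1 m U" "\<And>i. 0 \<le> u i"
  shows "bdd_above (excess m u ` U)"
proof (rule bdd_aboveI2)
  fix h assume "h \<in> U"
  then have "excess m u h \<le> (\<Sum>i<m. 1)"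
    unfolding excess_def pos_part_def
    using Assumption1_bounds(2)[OF assms(1)] assms(2)
    by (intro sum_mono) (smt (verit))
  then show "excess m u h \<le> (\<Sum>i<m. 1)" .
qed

text \<open>The witness \<open>w\<close> is the average of the maximisers chosen so far. Truncation
  at 1 and the reset only decrease \<open>u\<close>, hence an inequality against
  \<open>t * w\<close>. The quadratic is 0 + 1 + ... + (t - 1), the least total growth that the loop
  tests force.\<close>

lemma alg_reaches_invariant:
  assumes "alg_reaches m U t u" "Assumption1 m U" "U \<noteq> {}"
  shows "(\<forall>i. 0 \<le> u i \<and> u i \<le> 1) \<and> (\<exists>w\<in>U. \<forall>i. u i \<le> real t * w i) \<and>
         real t * (real t - 1) / 2 \<le> (\<Sum>i<m. u i)"
  using assms(1)
proof induction
  \<comment> \<open>At \<open>t = 0\<close> any element of \<open>U\<close> serves as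
    \<open>w\<close>, since both sides of the domination vanish.\<close>
  case init
  then show ?case using assms(3) by auto
next
  case (step t u h)
  have hU: "h \<in> U" and h_max: "\<And>g. g \<in> U \<Longrightarrow> excess m u g \<le> excess m u h"
    using step.hyps(3) by (auto simp: is_arg_max_linorder)
  note h_bounds = Assumption1_bounds(1,2)[OF assms(2) hU]
  have u_bounds: "\<And>i. 0 \<le> u i" "\<And>i. u i \<le> 1"
    using step.IH by auto
  obtain w where w: "w \<in> U" "\<And>i. u i \<le> real t * w i"
    using step.IH by auto
  have "(SUP g\<in>U. excess m u g) \<le> excess m u h"
    using assms(3) h_max by (rule cSUP_least)
  then have excess_gt: "real t < excess m u h"
    using step.hyps(2) by linarith
  \<comment> \<open>Coordinatewise, \<open>u i + pos_part (h i - u i)\<close> is the maximum of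
    \<open>u i\<close> and \<open>h i\<close>. The update is at least that: it stays 1 where
    \<open>u i = 1\<close>, and elsewhere it is min(1, u i + h i) with both terms in [0,1].\<close>
  have "(\<Sum>i<m. u i) + excess m u h \<le> (\<Sum>i<m. alg_update u h i)"
    unfolding excess_def sum.distrib[symmetric] alg_update_def pos_part_def
    using h_bounds u_bounds by (intro sum_mono) (smt (verit))
  moreover have "real t * (real t - 1) / 2 \<le> (\<Sum>i<m. u i)"
    using step.IH by blast
  moreover have "real (Suc t) * (real (Suc t) - 1) / 2 = real t * (real t - 1) / 2 + real t"
    by (simp add: field_simps)
  ultimately have sum_ge: "real (Suc t) * (real (Suc t) - 1) / 2 \<le> (\<Sum>i<m. alg_update u h i)"
    using excess_gt by linarith
  \<comment> \<open>Running average: \<open>h\<close> joins the \<open>t\<close> earlier maximisers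
    with equal weight.\<close>
  define w' where "w' = (real t / real (Suc t)) *\<^sub>R w + (1 / real (Suc t)) *\<^sub>R h"
  have "w' \<in> U"
    unfolding w'_def using assms(2) w(1) hU
    by (intro convexD) (auto simp: Assumption1_def field_simps)
  moreover have "alg_update u h i \<le> real (Suc t) * w' i" for i
  proof -
    have "real (Suc t) * w' i = real t * w i + h i"
      by (simp add: w'_def distrib_left del: of_nat_Suc)
    then show ?thesis
      using w(2)[of i] h_bounds(1)[of i] by (auto simp: alg_update_def)
  qed
  moreover have "0 \<le> alg_update u h i \<and> alg_update u h i \<le> 1" for i
    using u_bounds(1)[of i] h_bounds(1)[of i] by (simp add: alg_update_def)
  ultimately show ?case
    using sum_ge by blast
qed

lemma alg_returns_properties:
  assumes "alg_returns m U \<beta> v" "Assumption1 m U" "m \<ge> 1"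
  shows "\<beta> > 0" "v \<in> U" "real \<beta> \<le> 2 * sqrt (real m)"
    and "\<And>h. h \<in> U \<Longrightarrow> excess m (real \<beta> *\<^sub>R v) h \<le> real \<beta>"
proof -
  have e0: "unit_vector 0 \<in> U"
    using assms(2,3) by (simp add: Assumption1_def)
  obtain u where u: "alg_reaches m U \<beta> u" "\<not> (SUP h\<in>U. excess m u h) > real \<beta>"
      "v = (1 / real \<beta>) *\<^sub>R u"
    using assms(1) by (auto simp: alg_returns_def)
  have u_bounds: "\<And>i. 0 \<le> u i" "\<And>i. u i \<le> 1"
    and quad: "real \<beta> * (real \<beta> - 1) / 2 \<le> (\<Sum>i<m. u i)"
    using alg_reaches_invariant[OF u(1) assms(2)] e0 by auto
  obtain w where w: "w \<in> U" "\<And>i. u i \<le> real \<beta> * w i"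
    using alg_reaches_invariant[OF u(1) assms(2)] e0 by auto
  have excess_le: "excess m u h \<le> real \<beta>" if "h \<in> U" for h
    using cSUP_upper[OF that excess_bdd_above[where u = u, OF assms(2) u_bounds(1)]] u(2) by linarith
  show pos: "\<beta> > 0"
  \<comment> \<open>Stopping at 0 would leave \<open>u = 0\<close>, but a unit vector then has
    excess 1, more than the counter.\<close>
  proof (rule ccontr)
    assume "\<not> \<beta> > 0"
    then have "\<beta> = 0" by simp
    then have "u i = 0" for i
      using w(2)[of i] u_bounds(1)[of i] by simp
    then have "excess m u (unit_vector 0) = (\<Sum>i<m. if i = 0 then 1 else 0)"
      unfolding excess_def by (intro sum.cong) (auto simp: unit_vector_def pos_part_def)
    also have "\<dots> = 1"
      using assms(3) by simp
    finally show False
      using excess_le[OF e0] \<open>\<beta> = 0\<close> by simp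
  qed
  \<comment> \<open>Dividing the domination by \<beta> gives 0 \<le> v \<le> w, so down-monotonicity
    applies.\<close>
  show "v \<in> U"
    using w(1) by (rule Assumption1_down[OF assms(2)])
      (use pos u_bounds(1) w(2) in \<open>auto simp: u(3) field_simps\<close>)
  show "excess m (real \<beta> *\<^sub>R v) h \<le> real \<beta>" if "h \<in> U" for h
    using excess_le[OF that] pos by (simp add: u(3))
  have "(\<Sum>i<m. u i) \<le> (\<Sum>i<m. 1)"
    by (intro sum_mono u_bounds(2))
  then have quad': "real \<beta> * (real \<beta> - 1) \<le> 2 * real m"
    using quad by simp
  \<comment> \<open>For \<beta> \<ge> 2 the linear term is at most half the square, so it can be
    absorbed; \<beta> = 1 is covered by m \<ge> 1.\<close>
  have "(real \<beta>)\<^sup>2 \<le> 4 * real m"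
  proof (cases "\<beta> = 1")
    case True
    then show ?thesis using assms(3) by simp
  next
    case False
    then have "real \<beta> * 2 \<le> real \<beta> * real \<beta>"
      using pos by (intro mult_left_mono) auto
    then show ?thesis
      using quad' by (simp add: power2_eq_square algebra_simps)
  qed
  then have "real \<beta> \<le> sqrt (4 * real m)"
    by (rule real_le_rsqrt)
  then show "real \<beta> \<le> 2 * sqrt (real m)"
    by (simp add: real_sqrt_mult)
qed

section \<open>The scaled simplex and scaling of solutions\<close>

lemma scaled_simplex_generators:
  "real \<beta> *\<^sub>R v \<in> scaled_simplex m \<beta> v"
  "i < m \<Longrightarrow> real \<beta> *\<^sub>R unit_vector i \<in> scaled_simplex m \<beta> v"
  unfolding scaled_simplex_def by (intro imageI hull_inc; simp)+

lemma scaled_simplex_subset: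
  assumes "Assumption1 m U" "v \<in> U"
  shows "scaled_simplex m \<beta> v \<subseteq> (\<lambda>h. real \<beta> *\<^sub>R h) ` U"
  unfolding scaled_simplex_def
  using assms by (intro image_mono hull_minimal) (auto simp: Assumption1_def)

lemma AR_cost_upper:
  "h \<in> S \<Longrightarrow> ereal (dot n c x + dot n d (y h)) \<le> AR_cost n c d S x y"
  unfolding AR_cost_def plus_ereal.simps(1)[symmetric] by (intro add_left_mono SUP_upper)

lemma AR_cost_scaled_le:
  assumes "S \<subseteq> (\<lambda>h. r *\<^sub>R h) ` U" "r > 0" "S \<noteq> {}"
  shows "AR_cost n c d S (r *\<^sub>R x) (\<lambda>h. r *\<^sub>R y ((1 / r) *\<^sub>R h)) \<le> ereal r * AR_cost n c d U x y"
proof (cases "AR_cost n c d U x y = \<infinity>")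
  case True
  then show ?thesis using assms(2) by simp
next
  case False
  obtain h0 where h0: "h0 \<in> U"
    using assms by auto
  \<comment> \<open>The real cost at \<open>h0\<close> is a lower bound, which rules out the value
    minus infinity.\<close>
  then obtain k where k: "AR_cost n c d U x y = ereal k"
    using False AR_cost_upper[OF h0, of n c x d y] by (cases "AR_cost n c d U x y") auto
  have "ereal (dot n d (r *\<^sub>R y ((1 / r) *\<^sub>R h))) \<le> ereal (r * k - r * dot n c x)" if h: "h \<in> S" for h
  proof -
    obtain g where g: "g \<in> U" "h = r *\<^sub>R g"
      using h assms(1) by blast
    have "dot n c x + dot n d (y g) \<le> k"
      using AR_cost_upper[OF g(1), of n c x d y] k by simp
    then have "r * (dot n c x + dot n d (y g)) \<le> r * k"
      using assms(2) by (intro mult_left_mono) auto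
    then show ?thesis
      using assms(2) g(2) by (simp add: dot_scaleR algebra_simps)
  qed
  then have "(SUP h\<in>S. ereal (dot n d (r *\<^sub>R y ((1 / r) *\<^sub>R h)))) \<le> ereal (r * k - r * dot n c x)"
    by (intro SUP_least)
  then have "AR_cost n c d S (r *\<^sub>R x) (\<lambda>h. r *\<^sub>R y ((1 / r) *\<^sub>R h))
      \<le> ereal (r * dot n c x) + ereal (r * k - r * dot n c x)"
    unfolding AR_cost_def dot_scaleR by (intro add_left_mono)
  then show ?thesis
    by (simp add: k)
qed

text \<open>The constraints are homogeneous in (x, y, h), so multiplying a solution by
  \<open>r\<close> covers the scaled uncertainty set.\<close>

lemma AR_feasible_scaled:
  assumes "AR_feasible m n A B U x y" "S \<subseteq> (\<lambda>h. r *\<^sub>R h) ` U" "r > 0"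
  shows "AR_feasible m n A B S (r *\<^sub>R x) (\<lambda>h. r *\<^sub>R y ((1 / r) *\<^sub>R h))"
  unfolding AR_feasible_def
proof (intro conjI ballI allI impI)
  show "r *\<^sub>R x \<in> Rspace_nonneg n"
    using assms by (simp add: AR_feasible_def Rspace_nonneg_scaleR)
next
  fix h assume "h \<in> S"
  then obtain g where g: "g \<in> U" "h = r *\<^sub>R g"
    using assms(2) by auto
  then show "r *\<^sub>R y ((1 / r) *\<^sub>R h) \<in> Rspace_nonneg n"
    using assms by (simp add: AR_feasible_def Rspace_nonneg_scaleR)
  fix i assume "i < m"
  then have "r * g i \<le> r * (mat_vec n A x i + mat_vec n B (y g) i)"
    using assms(1,3) g(1) by (intro mult_left_mono) (auto simp: AR_feasible_def)
  then show "h i \<le> mat_vec n A (r *\<^sub>R x) i + mat_vec n B (r *\<^sub>R y ((1 / r) *\<^sub>R h)) i"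
    using g(2) assms(3) by (simp add: mat_vec_eq_dot dot_scaleR algebra_simps)
qed

section \<open>Feasibility and cost of the piecewise affine policy\<close>

lemma dot_pw_affine_policy:
  "dot n d (pw_affine_policy m \<beta> v y h) =
     (\<Sum>i<m. pos_part (h i - real \<beta> * v i) / real \<beta> * dot n d (y (real \<beta> *\<^sub>R unit_vector i)))
     + dot n d (y (real \<beta> *\<^sub>R v))"
  by (simp add: pw_affine_policy_def dot_add dot_scaleR dot_sum sum_distrib_left)

lemma sum_weights:
  "(\<Sum>i<m. pos_part (h i - real \<beta> * v i) / real \<beta>) = excess m (real \<beta> *\<^sub>R v) h / real \<beta>"
  by (simp add: excess_def sum_divide_distrib)

text \<open>Coordinatewise, h is at most \<beta> v plus the sum of the w_i \<beta> e_i, where w_i is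
  the i-th excess divided by \<beta>. The recourse for each generator covers it up to A x. The
  weights w_i sum to at most 1, so the total deficit is at most 2 A x.\<close>

lemma pw_affine_policy_feasible:
  assumes "AR_data m n A c d" "AR_feasible m n A B (scaled_simplex m \<beta> v) x y" "\<beta> > 0"
    and excess: "\<And>h. h \<in> U \<Longrightarrow> excess m (real \<beta> *\<^sub>R v) h \<le> real \<beta>"
  shows "AR_feasible m n A B U (2 *\<^sub>R x) (pw_affine_policy m \<beta> v y)"
  unfolding AR_feasible_def
proof (intro conjI ballI allI impI)
  have x: "x \<in> Rspace_nonneg n"
    and y: "\<And>g. g \<in> scaled_simplex m \<beta> v \<Longrightarrow> y g \<in> Rspace_nonneg n"
    and cover: "\<And>g j. g \<in> scaled_simplex m \<beta> v \<Longrightarrow> j < m \<Longrightarrow>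
      g j - dot n (A j) x \<le> dot n (B j) (y g)"
    using assms(2) by (auto simp: AR_feasible_def mat_vec_eq_dot algebra_simps)
  note gen = scaled_simplex_generators
  show "2 *\<^sub>R x \<in> Rspace_nonneg n"
    using x by (simp add: Rspace_nonneg_scaleR)
  fix h assume h: "h \<in> U"
  show "pw_affine_policy m \<beta> v y h \<in> Rspace_nonneg n"
    unfolding pw_affine_policy_def
    by (intro Rspace_nonneg_add Rspace_nonneg_scaleR Rspace_nonneg_sum pos_part_nonneg y gen) auto
  fix j assume j: "j < m"
  define a where "a = dot n (A j) x"
  define w where "w = (\<lambda>i. pos_part (h i - real \<beta> * v i) / real \<beta>)"
  have "a \<ge> 0"
    using assms(1) x j
    by (auto simp: a_def dot_def AR_data_def Rspace_nonneg_iff intro!: sum_nonneg)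
  moreover have "(\<Sum>i<m. w i) \<le> 1"
    using excess[OF h] assms(3) by (simp add: w_def sum_weights)
  \<comment> \<open>The sign of \<open>A\<close> enters here: \<open>a \<ge> 0\<close> allows the
    weight sum to be replaced by 1.\<close>
  ultimately have "(\<Sum>i<m. w i) * a \<le> a"
    using mult_right_mono by fastforce
  moreover have "(\<Sum>i<m. w i * ((real \<beta> *\<^sub>R unit_vector i) j - a))
      \<le> (\<Sum>i<m. w i * dot n (B j) (y (real \<beta> *\<^sub>R unit_vector i)))"
    unfolding a_def w_def
    by (intro sum_mono mult_left_mono cover gen j divide_nonneg_nonneg pos_part_nonneg) auto
  \<comment> \<open>In row \<open>j\<close> only the generator \<beta> e_j contributes, and \<beta>
    cancels the denominator of its weight.\<close>
  moreover have "(\<Sum>i<m. w i * ((real \<beta> *\<^sub>R unit_vector i) j - a))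
      = pos_part (h j - real \<beta> * v j) - (\<Sum>i<m. w i) * a"
  proof -
    have "(\<Sum>i<m. w i * (real \<beta> *\<^sub>R unit_vector i) j) = (\<Sum>i<m. if i = j then w i * real \<beta> else 0)"
      by (intro sum.cong) (auto simp: unit_vector_def)
    also have "\<dots> = pos_part (h j - real \<beta> * v j)"
      using j assms(3) by (simp add: w_def)
    finally show ?thesis
      by (simp add: right_diff_distrib sum_subtractf sum_distrib_right)
  qed
  moreover have "real \<beta> * v j - a \<le> dot n (B j) (y (real \<beta> *\<^sub>R v))"
    using cover[OF gen(1) j] by (simp add: a_def)
  moreover have "h j - real \<beta> * v j \<le> pos_part (h j - real \<beta> * v j)"
    by (simp add: pos_part_def)
  ultimately show "h j \<le> mat_vec n A (2 *\<^sub>R x) j + mat_vec n B (pw_affine_policy m \<beta> v y h) j"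
    unfolding mat_vec_eq_dot dot_pw_affine_policy dot_scaleR a_def[symmetric]
    by (simp add: w_def)
qed

text \<open>One copy of \<open>k\<close> pays for \<open>x\<close> and the recourse at \<beta> v.
  The other pays for the second \<open>x\<close> and the weighted recourses, each costing at most k
  - c x.\<close>

lemma pw_affine_policy_cost:
  assumes "c \<in> Rspace_nonneg n" "d \<in> Rspace_nonneg n" "x \<in> Rspace_nonneg n"
    and "y (real \<beta> *\<^sub>R v) \<in> Rspace_nonneg n"
    and bound: "\<And>g. g \<in> scaled_simplex m \<beta> v \<Longrightarrow> dot n c x + dot n d (y g) \<le> k"
    and "\<beta> > 0" "excess m (real \<beta> *\<^sub>R v) h \<le> real \<beta>"
  shows "dot n c (2 *\<^sub>R x) + dot n d (pw_affine_policy m \<beta> v y h) \<le> 2 * k"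
proof -
  define w where "w = (\<lambda>i. pos_part (h i - real \<beta> * v i) / real \<beta>)"
  \<comment> \<open>Nonnegativity of the second-stage budget is what lets the weight sum be bounded
    by 1 below.\<close>
  have k_ge: "0 \<le> k - dot n c x"
    using bound[OF scaled_simplex_generators(1)] dot_nonneg[OF assms(2,4)] by linarith
  have "(\<Sum>i<m. w i * dot n d (y (real \<beta> *\<^sub>R unit_vector i))) \<le> (\<Sum>i<m. w i * (k - dot n c x))"
    unfolding w_def
    using bound[OF scaled_simplex_generators(2)]
    by (intro sum_mono mult_left_mono divide_nonneg_nonneg pos_part_nonneg) (auto simp: algebra_simps)
  also have "\<dots> = (\<Sum>i<m. w i) * (k - dot n c x)"
    by (simp add: sum_distrib_right)
  also have "\<dots> \<le> 1 * (k - dot n c x)"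
    using assms(6,7) k_ge by (intro mult_right_mono) (auto simp: w_def sum_weights)
  finally show ?thesis
    using bound[OF scaled_simplex_generators(1)]
    by (simp add: dot_pw_affine_policy dot_scaleR w_def)
qed

text \<open>One factor 2 comes from the policy, a factor \<beta> from comparing the optima over the
  simplex and over \<open>U\<close>.\<close>

lemma pw_affine_policy_approximation:
  assumes A1: "Assumption1 m U" and v: "v \<in> U" and \<beta>: "\<beta> > 0"
    and excess: "\<And>h. h \<in> U \<Longrightarrow> excess m (real \<beta> *\<^sub>R v) h \<le> real \<beta>"
    and data: "AR_data m n A c d"
    and opt: "AR_optimal m n A B c d (scaled_simplex m \<beta> v) x y"
    and \<alpha>: "2 * real \<beta> \<le> \<alpha>"
  shows "AR_approximation m n A B c d U \<alpha> (2 *\<^sub>R x) (pw_affine_policy m \<beta> v y)"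
  unfolding AR_approximation_def
proof (intro conjI ballI)
  let ?S = "scaled_simplex m \<beta> v"
  have feas: "AR_feasible m n A B ?S x y"
    and z: "AR_cost n c d ?S x y = z_AR m n A B c d ?S" "z_AR m n A B c d ?S < \<infinity>"
    using opt by (auto simp: AR_optimal_def)
  have c: "c \<in> Rspace_nonneg n" and d: "d \<in> Rspace_nonneg n"
    using data by (auto simp: AR_data_def)
  have x: "x \<in> Rspace_nonneg n" and y: "y (real \<beta> *\<^sub>R v) \<in> Rspace_nonneg n"
    using feas scaled_simplex_generators(1) by (auto simp: AR_feasible_def)
  show "AR_feasible m n A B U (2 *\<^sub>R x) (pw_affine_policy m \<beta> v y)"
    using pw_affine_policy_feasible[OF data feas \<beta> excess] .
  fix h assume h: "h \<in> U"
  have cost_gen: "ereal (dot n c x + dot n d (y (real \<beta> *\<^sub>R v))) \<le> z_AR m n A B c d ?S"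
    using AR_cost_upper[OF scaled_simplex_generators(1)] z(1) by metis
  then obtain k where k: "z_AR m n A B c d ?S = ereal k"
    using z(2) by (cases "z_AR m n A B c d ?S") auto
  have bound: "dot n c x + dot n d (y g) \<le> k" if "g \<in> ?S" for g
    using AR_cost_upper[OF that, of n c x d y] z(1) k by simp
  have cost: "dot n c (2 *\<^sub>R x) + dot n d (pw_affine_policy m \<beta> v y h) \<le> 2 * k"
    using pw_affine_policy_cost[where m = m and y = y, OF c d x y bound \<beta> excess[OF h]] .
  have "k \<ge> 0"
    using cost_gen k dot_nonneg[OF c x] dot_nonneg[OF d y] by simp
  \<comment> \<open>Every solution over \<open>U\<close>, multiplied by \<beta>, competes with the
    optimum \<open>k\<close> over the simplex. The quotient form also covers an infinite optimum
    over \<open>U\<close>.\<close>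
  have scale: "ereal (k / real \<beta>) \<le> z_AR m n A B c d U"
    unfolding z_AR_def
  proof (rule Inf_greatest, clarify)
    fix x' y' assume f: "AR_feasible m n A B U x' y'"
    note sub = scaled_simplex_subset[OF A1 v, of \<beta>]
    let ?x = "real \<beta> *\<^sub>R x'" and ?y = "\<lambda>h. real \<beta> *\<^sub>R y' ((1 / real \<beta>) *\<^sub>R h)"
    have "ereal k \<le> AR_cost n c d ?S ?x ?y"
      unfolding k[symmetric] z_AR_def
      using AR_feasible_scaled[OF f sub] \<beta> by (intro Inf_lower) auto
    also have "\<dots> \<le> ereal (real \<beta>) * AR_cost n c d U x' y'"
      using scaled_simplex_generators(1) \<beta> by (intro AR_cost_scaled_le[OF sub]) auto
    finally show "ereal (k / real \<beta>) \<le> AR_cost n c d U x' y'"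
      using \<beta> by (cases "AR_cost n c d U x' y'") (auto simp: field_simps)
  qed
  have "2 * k = 2 * real \<beta> * (k / real \<beta>)"
    using \<beta> by simp
  also have "\<dots> \<le> \<alpha> * (k / real \<beta>)"
    using \<alpha> \<open>k \<ge> 0\<close> by (intro mult_right_mono) auto
  finally have "ereal (dot n c (2 *\<^sub>R x) + dot n d (pw_affine_policy m \<beta> v y h))
      \<le> ereal \<alpha> * ereal (k / real \<beta>)"
    using cost by simp
  also have "\<dots> \<le> ereal \<alpha> * z_AR m n A B c d U"
    using scale \<alpha> by (intro ereal_mult_left_mono) auto
  finally show "ereal (dot n c (2 *\<^sub>R x) + dot n d (pw_affine_policy m \<beta> v y h))
      \<le> ereal \<alpha> * z_AR m n A B c d U" .
qed

theorem theorem4p1: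
  shows "\<exists>C::real. C > 0 \<and>
    (\<forall>(m::nat) (U::rvec set) (\<beta>::nat) (v::rvec).
       m \<ge> 1 \<longrightarrow>
       compactin (Euclidean_space m) U \<longrightarrow>
       Assumption1 m U \<longrightarrow>
       alg_returns m U \<beta> v \<longrightarrow>
       v \<in> U \<and>
       (\<forall>(n::nat) (A::rmat) (B::rmat) (c::rvec) (d::rvec)
          (xhat::rvec) (yhat::rvec \<Rightarrow> rvec).
          AR_data m n A c d \<longrightarrow>
          AR_optimal m n A B c d (scaled_simplex m \<beta> v) xhat yhat \<longrightarrow>
          AR_approximation m n A B c d U (C * sqrt (real m))
            (2 *\<^sub>R xhat) (pw_affine_policy m \<beta> v yhat)))"
proof (intro exI[of _ 4] conjI allI impI)
  fix m U \<beta> v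
  assume "m \<ge> 1" and A1: "Assumption1 m U" and "alg_returns m U \<beta> v"
  note ret = alg_returns_properties[OF \<open>alg_returns m U \<beta> v\<close> A1 \<open>m \<ge> 1\<close>]
  show "v \<in> U"
    by (rule ret(2))
  fix n A B c d xhat yhat
  assume "AR_data m n A c d" "AR_optimal m n A B c d (scaled_simplex m \<beta> v) xhat yhat"
  \<comment> \<open>The constant 4 is the policy's factor 2 times the 2 in the bound \<beta> \<le> 2
    sqrt m.\<close>
  then show "AR_approximation m n A B c d U (4 * sqrt (real m)) (2 *\<^sub>R xhat)
      (pw_affine_policy m \<beta> v yhat)"
    using ret(3) by (intro pw_affine_policy_approximation[OF A1 ret(2,1,4)]) auto
qed simp

end
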